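(* Suppose the Hessian $H(\lambda)=\nabla^2 q(\lambda)$ of the dual function satisfies the following two conditions. (Lipschitz dual Hessian) There exists a constant $L>0$ such that $\|H(\lambda)-H(\bar\lambda)\|\le L\|\lambda-\bar\lambda\|$ for all $\lambda,\bar\lambda\in\mathbb{R}^n$. (Strictly convex dual function) There exists a constant $M>0$ such that $\|H(\lambda)^{-1}\|\le M$ for all $\lambda\in\mathbb{R}^n$. Consider the ADD-$N$ algorithm characterized by the iteration $\lambda_{k+1}=\lambda_k-\alpha_k\bar H_k^{(N)}g_k$. Let $\epsilon$ be a uniform bound on the norm of the Newton approximation errors $\epsilon_k=H_kd_k^{(N)}+g_k$, so that $\|\epsilon_k\|\le\epsilon$ for all $k$, and define the constant $$B=\epsilon+M^2L\,\epsilon^2 .$$ Assume that at time $k$ it holds $\|g_k\|\le \frac{1}{2M^2L}$, that the step sizes satisfy $\alpha_{k+m}=1$ for all $m\ge 0$, and that $N$ is chosen large enough to ensure that, for some $\delta\in(0,1/2)$, $$B+M^2L\,B^2\le\frac{\delta}{4M^2L}.$$ Then for all $m\ge 1$, $$\|g_{k+m}\|\le \frac{1}{2^{2^m}M^2L}+B+\frac{\delta}{M^2L}\,\frac{2^{2^m-1}-1}{2^{2^m}} .$$ In particular, as $m\to\infty$, $$\limsup_{m\to\infty}\|g_{k+m}\|\le B+\frac{\delta}{2M^2L}.$$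
   Context: Network setting. $\mathcal G=(\mathcal N,\mathcal E)$ is a connected directed graph with $\mathcal N=\{1,\dots,n\}$, $n\ge 2$, and $\mathcal E=\{1,\dots,E\}$; each edge $e=(i,j)$ goes from a node $i$ to a different node $j$. $A$ is the $n\times E$ node-edge incidence matrix: $[A]_{ij}=1$ if edge $j$ leaves node $i$, $-1$ if edge $j$ enters node $i$, and $0$ otherwise. $b\in\mathbb{R}^n$ satisfies $\sum_i b^i=0$. For each edge $e$, the cost $\phi_e:\mathbb{R}\to\mathbb{R}$ is twice continuously differentiable and strictly convex, with $\phi_e''>0$. The primal problem is to maximize $-f(x)=-\sum_{e=1}^E\phi_e(x^e)$ over $x\in\mathbb{R}^E$ subject to $Ax=b$. Dual function. $q(\lambda)=\sup_{x\in\mathbb{R}^E}\big(-\sum_e\phi_e(x^e)+\lambda'(Ax-b)\big)$ for $\lambda\in\mathbb{R}^n$. It is assumed that for every $\lambda$ the supremum is attained; the unique maximizer $x(\lambda)$ has components $x^e(\lambda)=(\phi_e')^{-1}(\lambda^i-\lambda^j)$ for $e=(i,j)$. The function $q$ is convex, with gradient $g(\lambda)=\nabla q(\lambda)=Ax(\lambda)-b$ and Hessian $H(\lambda)=\nabla^2q(\lambda)=A\,[\nabla^2f(x(\lambda))]^{-1}A'$, a weighted graph Laplacian; $\mathbf 1$ is an eigenvector of $H(\lambda)$ with eigenvalue $0$, and $H(\lambda)$ is invertible on the subspace $\mathbf 1^\perp$, in which the gradient lies. Write $g_k=g(\lambda_k)$ and $H_k=H(\lambda_k)$. ADD-$N$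 algorithm. Write $H_k=D_k-B_k$, where $D_k$ is the diagonal part of $H_k$ and $-B_k$ its off-diagonal part. For an integer $N\ge0$ define $$\bar H_k^{(N)}=\sum_{i=0}^N D_k^{-1/2}\big(D_k^{-1/2}B_kD_k^{-1/2}\big)^iD_k^{-1/2},\qquad d_k^{(N)}=-\bar H_k^{(N)}g_k .$$ The iteration starts from an arbitrary $\lambda_0\in\mathbb{R}^n$. Vector norms are Euclidean and matrix norms are the induced operator norms. *)

theory Defs
  imports "HOL-Analysis.Analysis" "Graph_Theory.Digraph_Component"
begin

text \<open>
  A network on \<open>n\<close> nodes and \<open>E\<close> edges is a loop-free \<open>('n, 'e) pre_digraph\<close> over finite types with
  \<open>verts G = UNIV\<close> and \<open>arcs G = UNIV\<close>, so that \<open>n = CARD('n)\<close> and \<open>E = CARD('e)\<close>. Edges are an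
  index set with endpoints \<open>tail G e\<close> and \<open>head G e\<close>; parallel edges are allowed. Connectedness is
  \<^const>\<open>Digraph_Component.connected\<close>, i.e. connectedness of the underlying undirected graph.
\<close>

definition network :: "('n::finite, 'e::finite) pre_digraph \<Rightarrow> bool" where
  "network G \<longleftrightarrow> loopfree_digraph G \<and> verts G = UNIV \<and> arcs G = UNIV
     \<and> Digraph_Component.connected G \<and> CARD('n) \<ge> 2"

definition incidence :: "('n::finite, 'e::finite) pre_digraph \<Rightarrow> real^'e^'n" where
  "incidence G = (\<chi> i e. if tail G e = i then 1 else if head G e = i then - 1 else 0)"

definition twice_cont_diff :: "(real \<Rightarrow> real) \<Rightarrow> bool" where
  "twice_cont_diff f \<longleftrightarrow> (\<forall>x. f differentiable (at x)) \<and> (\<forall>x. deriv f differentiable (at x))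
     \<and> continuous_on UNIV (deriv (deriv f))"

definition strictly_convex :: "(real \<Rightarrow> real) \<Rightarrow> bool" where
  "strictly_convex f \<longleftrightarrow> (\<forall>x y t. x \<noteq> y \<longrightarrow> 0 < t \<longrightarrow> t < 1 \<longrightarrow>
     f ((1 - t) * x + t * y) < (1 - t) * f x + t * f y)"

definition admissible_cost :: "(real \<Rightarrow> real) \<Rightarrow> bool" where
  "admissible_cost f \<longleftrightarrow> twice_cont_diff f \<and> strictly_convex f \<and> (\<forall>x. deriv (deriv f) x > 0)"

definition total_cost :: "('e::finite \<Rightarrow> real \<Rightarrow> real) \<Rightarrow> real^'e \<Rightarrow> real" where
  "total_cost \<phi> x = (\<Sum>e\<in>UNIV. \<phi> e (x $ e))"

definition lagrangian ::
  "('n::finite, 'e::finite) pre_digraph \<Rightarrow> real^'n \<Rightarrow> ('e \<Rightarrow> real \<Rightarrow> real) \<Rightarrow> real^'n \<Rightarrow> real^'e \<Rightarrow> real"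
where
  "lagrangian G b \<phi> u x = - total_cost \<phi> x + u \<bullet> (incidence G *v x - b)"

definition dual_attained ::
  "('n::finite, 'e::finite) pre_digraph \<Rightarrow> real^'n \<Rightarrow> ('e \<Rightarrow> real \<Rightarrow> real) \<Rightarrow> bool" where
  "dual_attained G b \<phi> \<longleftrightarrow> (\<forall>u. \<exists>x. is_arg_max (lagrangian G b \<phi> u) (\<lambda>_. True) x)"

text \<open>The supremum below is taken in \<^typ>\<open>real\<close>; it is meaningful under \<^const>\<open>dual_attained\<close>.\<close>

definition dual ::
  "('n::finite, 'e::finite) pre_digraph \<Rightarrow> real^'n \<Rightarrow> ('e \<Rightarrow> real \<Rightarrow> real) \<Rightarrow> real^'n \<Rightarrow> real" where
  "dual G b \<phi> u = (SUP x. lagrangian G b \<phi> u x)"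

definition gradient :: "('a::real_inner \<Rightarrow> real) \<Rightarrow> 'a \<Rightarrow> 'a" where
  "gradient f x = (THE D. GDERIV f x :> D)"

definition hessian :: "(real^'n \<Rightarrow> real) \<Rightarrow> real^'n \<Rightarrow> real^'n^'n" where
  "hessian f x = jacobian (gradient f) (at x)"

definition ones_perp :: "(real^'n) set" where
  "ones_perp = {v. orthogonal 1 v}"

text \<open>
  \<open>H(\<lambda>)\<close> annihilates the all-ones vector \<open>1\<close>, so \<open>H(\<lambda>)\<^sup>-\<^sup>1\<close> stands for the inverse of the restriction of
  \<open>H(\<lambda>)\<close> to the orthogonal complement of \<open>1\<close>, and its norm is the operator norm on that subspace.
  As for \<^const>\<open>onorm\<close>, the vector \<open>0\<close> contributes \<open>0 / 0 = 0\<close> to the supremum.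
\<close>

definition perp_inverse :: "real^'n^'n \<Rightarrow> real^'n \<Rightarrow> real^'n" where
  "perp_inverse H = inv_into ones_perp ((*v) H)"

definition onorm_on ::
  "'a::real_normed_vector set \<Rightarrow> ('a \<Rightarrow> 'b::real_normed_vector) \<Rightarrow> real" where
  "onorm_on S T = (SUP v\<in>S. norm (T v) / norm v)"

definition diag_part :: "real^'n^'n \<Rightarrow> real^'n^'n" where
  "diag_part H = (\<chi> i j. if i = j then H $ i $ j else 0)"

definition neg_off_diag :: "real^'n^'n \<Rightarrow> real^'n^'n" where
  "neg_off_diag H = diag_part H - H"

definition diag_inv_sqrt :: "real^'n^'n \<Rightarrow> real^'n^'n" where
  "diag_inv_sqrt D = (\<chi> i j. if i = j then 1 / sqrt (D $ i $ i) else 0)"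

text \<open>The class operations \<open>*\<close> and \<open>^\<close> on \<^typ>\<open>real^'n^'n\<close> are componentwise, hence this definition.\<close>

definition matrix_pow :: "real^'n^'n \<Rightarrow> nat \<Rightarrow> real^'n^'n" where
  "matrix_pow A i = (((**) A) ^^ i) (mat 1)"

definition add_approx :: "nat \<Rightarrow> real^'n^'n \<Rightarrow> real^'n^'n" where
  "add_approx N H =
     (let R = diag_inv_sqrt (diag_part H); B = neg_off_diag H
      in \<Sum>i\<in>{0..N}. R ** matrix_pow (R ** B ** R) i ** R)"

end

theory Submission
  imports Defs "HOL-Real_Asymp.Real_Asymp"
begin

text \<open>
  Attainment of the dual supremum forces each \<open>\<phi>\<^sub>e'\<close> to be a bijection of the reals, so the dual function
  is the sum of the convex conjugates of the costs, evaluated at the differences of \<open>\<lambda>\<close> along the edges,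
  minus a linear term. Hence its gradient depends on \<open>\<lambda>\<close> only modulo multiples of the all-ones vector,
  and its Hessian is a Laplacian with positive weights, invertible on \<open>1\<^sup>\<bottom>\<close> as the graph is connected.

  In a step \<open>d\<close> with residual \<open>r = H d + g\<close> one may therefore replace \<open>d\<close> by its projection \<open>p\<close> to \<open>1\<^sup>\<bottom>\<close>,
  for which \<open>\<parallel>p\<parallel> \<le> M (\<parallel>r\<parallel> + \<parallel>g\<parallel>)\<close>. The second-order Taylor bound, with error \<open>L/2 \<parallel>p\<parallel>\<^sup>2\<close>, gives
  \<open>\<parallel>g\<^sub>k\<^sub>+\<^sub>1\<parallel> \<le> M\<^sup>2L \<parallel>g\<^sub>k\<parallel>\<^sup>2 + B\<close>, and the claim is a statement about this scalar recursion.
\<close>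

section \<open>The scalar recursion\<close>

text \<open>Induction from \<open>m = 1\<close>. Squaring the bound \<open>s / a + B\<close> leaves
  three terms: \<open>2 * s \<le> 1\<close> reduces the cross term to the next \<open>B\<close>,
  \<open>small\<close> turns \<open>a * B^2\<close> into \<open>\<delta> / (4 * a)\<close>, and
  convexity handles \<open>s^2\<close>.\<close>

lemma quadratic_recursion_bound:
  fixes u :: "nat \<Rightarrow> real" and a B \<delta> :: real
  assumes a: "a > 0" and B: "B \<ge> 0" and \<delta>: "0 < \<delta>" "\<delta> < 1/2"
    and small: "B + a * B^2 \<le> \<delta> / (4 * a)"
    and nonneg: "\<And>m. u m \<ge> 0"
    and start: "u 0 \<le> 1 / (2 * a)"
    and rec: "\<And>m. u (Suc m) \<le> a * (u m)^2 + B"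
    and "m \<ge> 1"
  shows "u m \<le> (1 / 2 ^ (2 ^ m)) / a + B + \<delta> / a * (1/2 - 1 / 2 ^ (2 ^ m))"
  using \<open>m \<ge> 1\<close>
proof (induction m rule: dec_induct)
  case base
  have "a * (u 0)^2 \<le> a * (1 / (2 * a))^2"
    using start nonneg a by (intro mult_left_mono power_mono) auto
  also have "\<dots> = 1 / (4 * a)"
    using a by (simp add: power2_eq_square)
  finally have "u (Suc 0) \<le> 1 / (4 * a) + B"
    using rec[of 0] by linarith
  moreover have "\<delta> / a * (1/2 - 1/4) \<ge> 0"
    using a \<delta> by simp
  ultimately show ?case
    by (simp add: power2_eq_square)
next
  case (step m)
  define t where "t = 1 / (2::real) ^ (2 ^ m)"
  have sq: "1 / (2::real) ^ (2 ^ Suc m) = t^2"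
    by (simp add: t_def power_divide flip: power_mult)
  \<comment> \<open>Since \<open>m \<ge> 1\<close>, already \<open>t \<le> 1/4\<close>; this is what
    keeps \<open>2 * s\<close> below 1.\<close>
  have "(2::nat) ^ 1 \<le> 2 ^ m"
    using step.hyps by (intro power_increasing) auto
  then have "(2::real) ^ 2 \<le> 2 ^ (2 ^ m)"
    by (intro power_increasing) auto
  then have t: "0 \<le> t" "t \<le> 1/4"
    by (auto simp: t_def field_simps)
  define s where "s = (1 - \<delta>) * t + \<delta> / 2"
  have "(1 - \<delta>) * t \<le> 1/4 - \<delta>/4"
    using t \<delta> mult_left_mono[of t "1/4" "1 - \<delta>"] by (simp add: diff_divide_distrib)
  then have "2 * s \<le> 1"
    using \<delta> unfolding s_def by simp
  txt \<open>\<open>s\<close> is a convex combination of \<open>t\<close> and \<open>1/2\<close>; this is convexity of the square.\<close>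
  have "s^2 = (1 - \<delta>) * t^2 + \<delta> / 4 - \<delta> * (1 - \<delta>) * (t - 1/2)^2"
    unfolding s_def by (simp add: power2_eq_square field_simps)
  then have convex: "s^2 \<le> (1 - \<delta>) * t^2 + \<delta> / 4"
    using \<delta> by simp
  have "s / a = t / a + \<delta> / a * (1/2 - t)"
    using a by (simp add: s_def field_simps)
  then have "u m \<le> s / a + B"
    using step.IH unfolding t_def[symmetric] by linarith
  then have "a * (u m)^2 \<le> a * (s / a + B)^2"
    using nonneg a by (intro mult_left_mono power_mono) auto
  also have "\<dots> = s^2 / a + (2 * s) * B + a * B^2"
    using a by (simp add: power2_eq_square field_simps)
  also have "\<dots> \<le> s^2 / a + B + a * B^2"
    using mult_right_mono[of "2 * s" 1 B] \<open>2 * s \<le> 1\<close> B by simp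
  also have "\<dots> \<le> s^2 / a + \<delta> / (4 * a)"
    using small by simp
  also have "\<dots> \<le> ((1 - \<delta>) * t^2 + \<delta> / 4) / a + \<delta> / (4 * a)"
    using convex a by (intro add_right_mono divide_right_mono) auto
  \<comment> \<open>The two quarters of \<open>\<delta>\<close>, one from convexity and one from
    \<open>small\<close>, add up to the \<open>\<delta> / 2\<close> of the next bound.\<close>
  also have "\<dots> = t^2 / a + \<delta> / a * (1/2 - t^2)"
    using a by (simp add: field_simps)
  finally show ?case
    using rec[of m] unfolding sq by linarith
qed

section \<open>Taylor bound and inversion on \<open>ones_perp\<close>\<close>

text \<open>Mean value inequality on the segment from \<open>x\<close> to \<open>x + v\<close>, with
  the majorant \<open>L / 2 * (norm v)^2 * s^2\<close>.\<close>

lemma derivative_lipschitz_imp_quadratic_bound: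
  fixes g :: "real^'n \<Rightarrow> real^'n" and H :: "real^'n \<Rightarrow> real^'n^'n"
  assumes deriv: "\<And>x. (g has_derivative (*v) (H x)) (at x)"
    and lip: "\<And>x y. onorm ((*v) (H x - H y)) \<le> L * norm (x - y)"
  shows "norm (g (x + v) - g x - H x *v v) \<le> L / 2 * (norm v)^2"
proof -
  \<comment> \<open>Subtracting the linear term makes \<open>f 1 - f 0\<close> the Taylor remainder
    and the derivative of \<open>f\<close> an increment of \<open>H\<close> applied to
    \<open>v\<close>.\<close>
  define f where "f s = g (x + s *\<^sub>R v) - s *\<^sub>R (H x *v v)" for s :: real
  have f: "(f has_vector_derivative (H (x + s *\<^sub>R v) *v v - H x *v v)) (at s within S)" for s S
  proof -
    have "((\<lambda>s. x + s *\<^sub>R v) has_derivative (\<lambda>h. h *\<^sub>R v)) (at s within S)"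
      by (auto intro!: derivative_eq_intros)
    from has_derivative_compose[OF this deriv]
    have "((\<lambda>s. g (x + s *\<^sub>R v)) has_vector_derivative (H (x + s *\<^sub>R v) *v v)) (at s within S)"
      unfolding has_vector_derivative_def
      by (simp add: matrix_vector_mult_scaleR)
    then show ?thesis
      unfolding f_def by (auto intro!: derivative_eq_intros)
  qed
  have q: "((\<lambda>s. L / 2 * (norm v)^2 * s^2) has_vector_derivative (L * (norm v)^2 * s)) (at s within S)"
    for s :: real and S
    unfolding has_real_derivative_iff_has_vector_derivative[symmetric]
    by (auto intro!: derivative_eq_intros)
  have bound: "norm (H (x + s *\<^sub>R v) *v v - H x *v v) \<le> L * (norm v)^2 * s" if "0 < s" for s
  proof -
    have "norm (H (x + s *\<^sub>R v) *v v - H x *v v) = norm ((H (x + s *\<^sub>R v) - H x) *v v)"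
      by (simp add: matrix_vector_mult_diff_rdistrib)
    also have "\<dots> \<le> onorm ((*v) (H (x + s *\<^sub>R v) - H x)) * norm v"
      by (intro onorm) simp
    also have "\<dots> \<le> (L * norm (s *\<^sub>R v)) * norm v"
      using lip[of "x + s *\<^sub>R v" x] by (intro mult_right_mono) auto
    finally show ?thesis
      using that by (simp add: power2_eq_square mult_ac)
  qed
  have "norm (f 1 - f 0) \<le> L / 2 * (norm v)^2 * 1^2 - L / 2 * (norm v)^2 * 0^2"
  proof (rule differentiable_bound_general)
    show "continuous_on {0..1} f"
      using f by (rule continuous_on_vector_derivative)
    show "continuous_on {0..1} (\<lambda>s::real. L / 2 * (norm v)^2 * s^2)"
      by (intro continuous_intros)
  qed (use f q bound in auto)
  then show ?thesis
    by (simp add: f_def algebra_simps)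
qed

text \<open>By a dimension count \<open>H\<close> is a bijection of \<open>ones_perp\<close>, so
  \<open>perp_inverse\<close> undoes it there. The supremum in \<open>onorm_on\<close> bounds its
  members only once the quotients are known to be bounded.\<close>

lemma perp_inverse_bound:
  fixes H :: "real^'n^'n"
  assumes maps: "\<And>v. v \<in> ones_perp \<Longrightarrow> H *v v \<in> ones_perp"
    and inj: "\<And>v. \<lbrakk>v \<in> ones_perp; H *v v = 0\<rbrakk> \<Longrightarrow> v = 0"
    and v: "v \<in> ones_perp"
  shows "norm v \<le> onorm_on ones_perp (perp_inverse H) * norm (H *v v)"
proof -
  have sub: "subspace (ones_perp :: (real^'n) set)"
    unfolding ones_perp_def by (rule subspace_orthogonal_to_vector)
  have inj_on: "inj_on ((*v) H) ones_perp"
    using inj by (subst linear_inj_on_iff_eq_0[OF matrix_vector_mul_linear sub]) blast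
  have "(*v) H ` ones_perp = ones_perp"
  proof (rule subspace_dim_equal)
    show "subspace ((*v) H ` ones_perp)"
      by (intro linear_subspace_image matrix_vector_mul_linear sub)
    show "dim (ones_perp :: (real^'n) set) \<le> dim ((*v) H ` ones_perp)"
      using inj_on by (subst dim_image_eq) (auto simp: span_eq_iff[THEN iffD2, OF sub])
  qed (use sub maps in auto)
  \<comment> \<open>An injective linear map on a closed subspace is bounded below;
    \<open>1 / c\<close> then bounds the quotients.\<close>
  obtain c where c: "c > 0" "\<And>x. x \<in> ones_perp \<Longrightarrow> c * norm x \<le> norm (H *v x)"
    using injective_imp_isometric[OF closed_subspace[OF sub] sub, of "(*v) H"] inj by auto
  have inv: "perp_inverse H (H *v x) = x" if "x \<in> ones_perp" for x
    unfolding perp_inverse_def using that inj_on by (rule inv_into_f_f[rotated])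
  have "bdd_above ((\<lambda>w. norm (perp_inverse H w) / norm w) ` ones_perp)"
  proof (rule bdd_aboveI2)
    fix w :: "real^'n" assume "w \<in> ones_perp"
    then obtain x where x: "x \<in> ones_perp" "w = H *v x"
      using \<open>(*v) H ` ones_perp = ones_perp\<close> by blast
    show "norm (perp_inverse H w) / norm w \<le> 1 / c"
      using c x inv[of x] by (cases "w = 0") (auto simp: field_simps)
  qed
  then have "norm (perp_inverse H (H *v v)) / norm (H *v v) \<le> onorm_on ones_perp (perp_inverse H)"
    unfolding onorm_on_def using maps[OF v] by (intro cSUP_upper)
  moreover have "H *v v \<noteq> 0" if "v \<noteq> 0"
    using inj[OF v] that by blast
  ultimately show ?thesis
    using inv[OF v] by (cases "v = 0") (simp_all add: pos_divide_le_eq)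
qed


section \<open>Convex conjugates of the costs\<close>

text \<open>A positive second derivative makes \<open>deriv f\<close> strictly increasing, so
  surjectivity gives a true inverse. The third function is the Legendre conjugate of
  \<open>f\<close>; the terms with the derivative of the inverse cancel.\<close>

lemma surj_deriv_inverse:
  assumes adm: "admissible_cost f" and surj: "surj (deriv f)"
  shows deriv_inv_eq: "deriv f x = y \<longleftrightarrow> x = inv (deriv f) y"
    and DERIV_deriv_inverse:
      "(inv (deriv f) has_real_derivative inverse (deriv (deriv f) (inv (deriv f) y))) (at y)"
    and DERIV_conjugate:
      "((\<lambda>y. y * inv (deriv f) y - f (inv (deriv f) y)) has_real_derivative inv (deriv f) y) (at y)"
proof -
  let ?\<psi> = "inv (deriv f)"
  have f1: "(f has_real_derivative deriv f x) (at x)" for x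
    using adm by (simp add: admissible_cost_def twice_cont_diff_def DERIV_deriv_iff_real_differentiable)
  have f2: "(deriv f has_real_derivative deriv (deriv f) x) (at x)" for x
    using adm by (simp add: admissible_cost_def twice_cont_diff_def DERIV_deriv_iff_real_differentiable)
  have pos: "deriv (deriv f) x > 0" for x
    using adm by (auto simp: admissible_cost_def)
  have mono: "strict_mono (deriv f)"
  proof (rule strict_monoI)
    show "deriv f x < deriv f y" if "x < y" for x y
      using that by (rule DERIV_pos_imp_increasing) (rule exI, rule conjI, rule f2, rule pos)
  qed
  have inj: "inj (deriv f)"
    using mono by (rule strict_mono_imp_inj_on)
  have right: "deriv f (?\<psi> y) = y" for y
    using surj by (rule surj_f_inv_f)
  show "deriv f x = y \<longleftrightarrow> x = ?\<psi> y" for x y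
    using right[of y] inv_f_f[OF inj, of x] by auto
  \<comment> \<open>A monotone function with open range is continuous; here the range is the whole
    line.\<close>
  have "continuous_on UNIV ?\<psi>"
  proof (rule continuous_onI_mono)
    show "open (range ?\<psi>)"
      using inj by (simp add: inj_imp_surj_inv)
    show "?\<psi> x \<le> ?\<psi> y" if "x \<le> y" for x y
      using that strict_mono_less_eq[OF mono, of "?\<psi> x" "?\<psi> y"] by (simp add: right)
  qed
  then have "isCont ?\<psi> y" for y
    by (simp add: continuous_on_eq_continuous_at)
  then show \<psi>: "(?\<psi> has_real_derivative inverse (deriv (deriv f) (?\<psi> y))) (at y)" for y
    using pos[of "?\<psi> y"]
    by (intro DERIV_inverse_function[where f = "deriv f" and a = "y - 1" and b = "y + 1", OF f2])
       (simp_all add: right)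
  have "((\<lambda>y. f (?\<psi> y)) has_real_derivative deriv f (?\<psi> y) * inverse (deriv (deriv f) (?\<psi> y))) (at y)" for y
    by (rule DERIV_chain2[OF f1 \<psi>])
  from DERIV_diff[OF DERIV_mult[OF DERIV_ident \<psi>] this]
  show "((\<lambda>y. y * ?\<psi> y - f (?\<psi> y)) has_real_derivative ?\<psi> y) (at y)" for y
    by (simp add: right mult.commute)
qed

section \<open>Incidence matrix and weighted Laplacians\<close>

text \<open>The transposed incidence matrix takes differences along edges. Loop-freeness matters:
  the nested conditional would give a loop a column with entry 1 instead of 0.\<close>

lemma inner_incidence:
  fixes G :: "('n::finite, 'e::finite) pre_digraph"
  assumes "network G"
  shows "u \<bullet> (incidence G *v x) = (\<Sum>e\<in>UNIV. (u $ tail G e - u $ head G e) * x $ e)"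
proof -
  have loopfree: "tail G e \<noteq> head G e" for e
    using assms by (auto simp: network_def loopfree_digraph_def loopfree_digraph_axioms_def)
  have "(\<Sum>i\<in>UNIV. u $ i * incidence G $ i $ e) = u $ tail G e - u $ head G e" for e
  proof -
    have "(\<Sum>i\<in>UNIV. u $ i * incidence G $ i $ e)
        = (\<Sum>i\<in>UNIV. (if i = tail G e then u $ i else 0) - (if i = head G e then u $ i else 0))"
      using loopfree[of e] by (intro sum.cong) (auto simp: incidence_def)
    then show ?thesis
      by (simp add: sum_subtractf)
  qed
  moreover have "u \<bullet> (incidence G *v x) = (\<Sum>e\<in>UNIV. (\<Sum>i\<in>UNIV. u $ i * incidence G $ i $ e) * x $ e)"
    by (simp add: inner_vec_def matrix_vector_mult_def sum_distrib_left sum_distrib_right mult.assoc)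
       (rule sum.swap)
  ultimately show ?thesis
    by simp
qed

text \<open>Induction along an undirected walk: each arc preserves the value in both
  directions.\<close>

lemma connected_imp_constant:
  fixes G :: "('n::finite, 'e::finite) pre_digraph" and v :: "'n \<Rightarrow> 'a"
  assumes "network G" and edge: "\<And>e. v (tail G e) = v (head G e)"
  shows "v i = v j"
proof -
  have "(i, j) \<in> rtrancl_on UNIV (arcs_ends (with_proj (mk_symmetric G)))"
    using assms(1)
    by (auto simp: network_def Digraph_Component.connected_def strongly_connected_def reachable_def)
  then show ?thesis
  proof induction
    case (step y z)
    then show ?case using edge
      by (auto simp: parcs_mk_symmetric)
  qed simp
qed

context
  fixes G :: "('n::finite, 'e::finite) pre_digraph" and w :: "'e \<Rightarrow> real" and H :: "real^'n^'n"
  assumes network: "network G" and w_pos: "\<And>e. w e > 0"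
    and laplacian: "\<And>h. H *v h = incidence G *v (\<chi> e. w e * (h $ tail G e - h $ head G e))"
begin

lemma laplacian_in_ones_perp: "H *v v \<in> ones_perp"
  unfolding ones_perp_def orthogonal_def laplacian
  by (simp add: inner_incidence[OF network])

text \<open>The energy \<open>v \<bullet> (H *v v)\<close> is a sum of positively weighted squared
  edge differences. If it vanishes, \<open>v\<close> is constant by connectedness, and orthogonality
  to the all-ones vector makes the constant 0.\<close>

lemma laplacian_eq_0_imp:
  assumes "v \<in> ones_perp" "H *v v = 0"
  shows "v = 0"
proof -
  have "(\<Sum>e\<in>UNIV. w e * (v $ tail G e - v $ head G e)^2) = v \<bullet> (H *v v)"
    unfolding laplacian inner_incidence[OF network]
    by (intro sum.cong) (auto simp: power2_eq_square)
  also have "\<dots> = 0"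
    using assms by simp
  finally have "\<forall>e\<in>UNIV. w e * (v $ tail G e - v $ head G e)^2 = 0"
    by (subst (asm) sum_nonneg_eq_0_iff) (auto simp: less_imp_le[OF w_pos])
  then have "v $ tail G e = v $ head G e" for e
    using w_pos[of e] by (auto simp: less_le)
  then have const: "v $ i = v $ j" for i j
    using connected_imp_constant[OF network, of "\<lambda>i. v $ i"] by blast
  have "(\<Sum>i\<in>UNIV. v $ i) = 0"
    using assms(1) by (simp add: ones_perp_def orthogonal_def inner_vec_def)
  moreover have "(\<Sum>i\<in>UNIV. v $ i) = (\<Sum>i\<in>(UNIV::'n set). v $ j)" for j
    using const by (intro sum.cong refl const)
  ultimately show "v = 0"
    by (simp add: vec_eq_iff)
qed

end


section \<open>Gradient and Hessian of the dual function\<close>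

context
  fixes G :: "('n::finite, 'e::finite) pre_digraph" and b :: "real^'n" and \<phi> :: "'e \<Rightarrow> real \<Rightarrow> real"
  assumes network: "network G" and cost: "\<And>e. admissible_cost (\<phi> e)"
    and attained: "dual_attained G b \<phi>"
begin

lemma lagrangian_eq:
  "lagrangian G b \<phi> u x
     = (\<Sum>e\<in>UNIV. (u $ tail G e - u $ head G e) * x $ e - \<phi> e (x $ e)) - u \<bullet> b"
  by (simp add: lagrangian_def total_cost_def inner_diff_right inner_incidence[OF network]
      sum_subtractf)

text \<open>The Lagrangian separates over edges, so varying one coordinate of a maximizer gives a
  one-dimensional maximum with vanishing derivative.\<close>

lemma deriv_cost_at_maximizer:
  assumes "is_arg_max (lagrangian G b \<phi> u) (\<lambda>_. True) x"
  shows "deriv (\<phi> e) (x $ e) = u $ tail G e - u $ head G e"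
proof -
  let ?y = "u $ tail G e - u $ head G e"
  have le: "?y * t - \<phi> e t \<le> ?y * x $ e - \<phi> e (x $ e)" for t
  proof -
    let ?x' = "\<chi> e'. if e' = e then t else x $ e'"
    have "lagrangian G b \<phi> u ?x' \<le> lagrangian G b \<phi> u x"
      using assms by (simp add: is_arg_max_linorder)
    then show ?thesis
      by (simp add: lagrangian_eq sum.remove[of UNIV e])
  qed
  have "(\<phi> e has_real_derivative deriv (\<phi> e) (x $ e)) (at (x $ e))"
    using cost[of e] by (simp add: admissible_cost_def twice_cont_diff_def DERIV_deriv_iff_real_differentiable)
  then have "((\<lambda>t. ?y * t - \<phi> e t) has_real_derivative ?y - deriv (\<phi> e) (x $ e)) (at (x $ e))"
    by (auto intro!: derivative_eq_intros)
  then have "?y - deriv (\<phi> e) (x $ e) = 0"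
    by (rule DERIV_local_max[OF _ zero_less_one]) (use le in auto)
  then show ?thesis
    by simp
qed

text \<open>The multiplier \<open>axis (tail G e) y\<close> has difference \<open>y\<close> along
  \<open>e\<close>, as the head is another node; attainment then provides a point with derivative
  \<open>y\<close>.\<close>

lemma surj_deriv_cost: "surj (deriv (\<phi> e))"
proof -
  have "tail G e \<noteq> head G e"
    using network by (auto simp: network_def loopfree_digraph_def loopfree_digraph_axioms_def)
  then have "\<exists>x. y = deriv (\<phi> e) x" for y
    using attained deriv_cost_at_maximizer[of "axis (tail G e) y" _ e]
    by (auto simp: dual_attained_def axis_def)
  then show ?thesis
    by (simp add: surj_def)
qed

lemma dual_eq:
  "dual G b \<phi> u = (\<Sum>e\<in>UNIV. (\<lambda>y. y * inv (deriv (\<phi> e)) y - \<phi> e (inv (deriv (\<phi> e)) y))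
                              (u $ tail G e - u $ head G e)) - u \<bullet> b"
proof -
  obtain x where x: "is_arg_max (lagrangian G b \<phi> u) (\<lambda>_. True) x"
    using attained unfolding dual_attained_def by blast
  have "dual G b \<phi> u = lagrangian G b \<phi> u x"
    unfolding dual_def using x
    by (intro cSup_eq_maximum) (auto simp: is_arg_max_linorder)
  moreover have "x $ e = inv (deriv (\<phi> e)) (u $ tail G e - u $ head G e)" for e
    using deriv_cost_at_maximizer[OF x] deriv_inv_eq[OF cost surj_deriv_cost] by blast
  ultimately show ?thesis
    by (simp add: lagrangian_eq)
qed

text \<open>Each conjugate in \<open>dual_eq\<close> has the optimal flow on its edge as derivative;
  \<open>inner_incidence\<close> collects these into one inner product with the direction.\<close>

lemma gradient_dual:
  "gradient (dual G b \<phi>) u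
     = incidence G *v (\<chi> e. inv (deriv (\<phi> e)) (u $ tail G e - u $ head G e)) - b" (is "_ = ?g")
proof -
  have "GDERIV (dual G b \<phi>) u :> ?g"
    unfolding gderiv_def dual_eq inner_diff_right inner_incidence[OF network] vec_lambda_beta
    by (intro has_derivative_diff has_derivative_sum bounded_linear_imp_has_derivative
        bounded_linear_inner_left bounded_linear_sub bounded_linear_vec_nth
        DERIV_compose_FDERIV[OF DERIV_conjugate[OF cost surj_deriv_cost]])
  moreover have "D = ?g" if "GDERIV (dual G b \<phi>) u :> D" for D
  proof -
    have "(\<lambda>h. h \<bullet> D) = (\<lambda>h. h \<bullet> ?g)"
      using that calculation unfolding gderiv_def by (rule has_derivative_unique)
    then have "\<forall>h. h \<bullet> D = h \<bullet> ?g"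
      by (intro allI) (rule fun_cong)
    then show ?thesis
      by (rule vector_eq_ldot[THEN iffD1])
  qed
  ultimately show ?thesis
    unfolding gradient_def by blast
qed

lemma
  shows gradient_dual_has_derivative:
      "(gradient (dual G b \<phi>) has_derivative (*v) (hessian (dual G b \<phi>) u)) (at u)"
    and hessian_dual_mult:
      "hessian (dual G b \<phi>) u *v h = incidence G *v (\<chi> e.
         inverse (deriv (deriv (\<phi> e)) (inv (deriv (\<phi> e)) (u $ tail G e - u $ head G e)))
           * (h $ tail G e - h $ head G e))" (is "_ = ?H h")
proof -
  have "((\<lambda>u. \<chi> e. inv (deriv (\<phi> e)) (u $ tail G e - u $ head G e)) has_derivative
         (\<lambda>h. \<chi> e. (h $ tail G e - h $ head G e)
            * inverse (deriv (deriv (\<phi> e)) (inv (deriv (\<phi> e)) (u $ tail G e - u $ head G e)))))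
        (at u)"
    (is "(?x has_derivative ?x') _")
  proof (subst has_derivative_componentwise_within, rule ballI)
    fix i :: "real^'e" assume "i \<in> Basis"
    then obtain e where i: "i = axis e 1"
      by (auto simp: Basis_vec_def)
    show "((\<lambda>u. ?x u \<bullet> i) has_derivative (\<lambda>h. ?x' h \<bullet> i)) (at u)"
      unfolding i inner_axis inner_real_def mult_1_right vec_lambda_beta
      by (intro DERIV_compose_FDERIV[OF DERIV_deriv_inverse[OF cost surj_deriv_cost]]
          bounded_linear_imp_has_derivative bounded_linear_sub bounded_linear_vec_nth)
  qed
  then have "((\<lambda>u. incidence G *v ?x u - b) has_derivative (\<lambda>h. incidence G *v ?x' h - 0)) (at u)"
    by (intro has_derivative_diff has_derivative_const
        bounded_linear.has_derivative[OF matrix_vector_mul_bounded_linear])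
  then have deriv: "(gradient (dual G b \<phi>) has_derivative ?H) (at u)"
    by (simp add: gradient_dual[abs_def] mult.commute)
  then show *: "(gradient (dual G b \<phi>) has_derivative (*v) (hessian (dual G b \<phi>) u)) (at u)"
    unfolding hessian_def using jacobian_works differentiableI by blast
  show "hessian (dual G b \<phi>) u *v h = ?H h"
    using has_derivative_unique[OF * deriv] by (rule fun_cong)
qed

lemma gradient_dual_in_ones_perp:
  assumes "(\<Sum>i\<in>UNIV. b $ i) = 0"
  shows "gradient (dual G b \<phi>) u \<in> ones_perp"
proof -
  have "1 \<bullet> b = 0"
    using assms by (simp add: inner_vec_def)
  then show ?thesis
    unfolding ones_perp_def orthogonal_def gradient_dual
    by (simp add: inner_diff_right inner_incidence[OF network])
qed

section \<open>One inexact Newton step\<close>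

lemma inexact_newton_step:
  fixes u d :: "real^'n" and L M :: real
  defines "g \<equiv> gradient (dual G b \<phi>)" and "H \<equiv> hessian (dual G b \<phi>)"
  defines "r \<equiv> H u *v d + g u"
  assumes balanced: "(\<Sum>i\<in>UNIV. b $ i) = 0"
    and "L \<ge> 0" and lip: "\<And>\<mu> \<nu>. onorm ((*v) (H \<mu> - H \<nu>)) \<le> L * norm (\<mu> - \<nu>)"
    and "onorm_on ones_perp (perp_inverse (H u)) \<le> M"
  shows "norm (g (u + d)) \<le> norm r + M^2 * L * (norm r)^2 + M^2 * L * (norm (g u))^2"
proof -
  \<comment> \<open>\<open>c\<close> is the mean of \<open>d\<close>, so subtracting it gives the
    orthogonal projection \<open>p\<close> of \<open>d\<close> onto
    \<open>ones_perp\<close>.\<close>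
  define c where "c = (\<Sum>i\<in>UNIV. d $ i) / real CARD('n)"
  define p where "p = d - c *\<^sub>R 1"
  have p: "p \<in> ones_perp"
    by (simp add: ones_perp_def orthogonal_def p_def c_def inner_vec_def sum_subtractf)
  have p_diff: "p $ i - p $ j = d $ i - d $ j" for i j
    by (simp add: p_def)
  have "(u + p) $ i - (u + p) $ j = (u + d) $ i - (u + d) $ j" for i j
    using p_diff[of i j] by simp
  then have g_p: "g (u + d) = g (u + p)"
    by (simp only: g_def gradient_dual)
  have "H u *v p = H u *v d"
    by (simp only: H_def hessian_dual_mult p_diff)
  then have H_p: "H u *v p = r - g u"
    by (simp add: r_def)
  let ?w = "\<lambda>e. inverse (deriv (deriv (\<phi> e)) (inv (deriv (\<phi> e)) (u $ tail G e - u $ head G e)))"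
  have w: "?w e > 0" for e
    using cost[of e] by (simp add: admissible_cost_def)
  have lap: "H u *v h = incidence G *v (\<chi> e. ?w e * (h $ tail G e - h $ head G e))" for h
    unfolding H_def by (rule hessian_dual_mult)
  have "norm p \<le> onorm_on ones_perp (perp_inverse (H u)) * norm (H u *v p)"
    using laplacian_in_ones_perp[of G ?w, OF network w lap]
      laplacian_eq_0_imp[of G ?w, OF network w lap] p
    by (rule perp_inverse_bound)
  also have "\<dots> \<le> M * norm (H u *v p)"
    using assms by (intro mult_right_mono) auto
  finally have "norm p \<le> M * norm (r - g u)"
    unfolding H_p .
  then have "(norm p)^2 \<le> M^2 * (norm (r - g u))^2"
    using power_mono[of "norm p" "M * norm (r - g u)" 2] by (simp add: power_mult_distrib)
  also have "(norm (r - g u))^2 \<le> (norm r + norm (g u))^2"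
    by (intro power_mono norm_triangle_ineq4) auto
  \<comment> \<open>This separates residual and gradient; the factor 2 cancels against the
    \<open>L / 2\<close> of the Taylor bound.\<close>
  also have "\<dots> \<le> 2 * ((norm r)^2 + (norm (g u))^2)"
    using sum_squares_bound[of "norm r" "norm (g u)"] by (simp add: power2_sum)
  finally have p2: "(norm p)^2 \<le> M^2 * (2 * ((norm r)^2 + (norm (g u))^2))"
    by (simp add: mult_left_mono)
  have "norm (g (u + p) - g u - H u *v p) \<le> L / 2 * (norm p)^2"
    using gradient_dual_has_derivative lip unfolding g_def H_def
    by (rule derivative_lipschitz_imp_quadratic_bound)
  also have "\<dots> \<le> L / 2 * (M^2 * (2 * ((norm r)^2 + (norm (g u))^2)))"
    using p2 \<open>L \<ge> 0\<close> by (intro mult_left_mono) auto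
  also have "\<dots> = M^2 * L * (norm r)^2 + M^2 * L * (norm (g u))^2"
    by (simp add: algebra_simps)
  \<comment> \<open>By \<open>H_p\<close>, the linear model at \<open>u + p\<close> has value
    exactly \<open>r\<close>.\<close>
  finally have "norm (g (u + p) - r) \<le> M^2 * L * (norm r)^2 + M^2 * L * (norm (g u))^2"
    by (simp add: H_p)
  then show ?thesis
    unfolding g_p using norm_triangle_sub[of "g (u + p)" r] by linarith
qed

end

section \<open>The ADD-N iterates and their limit superior\<close>

theorem proposition2:
  fixes G :: "('n::finite, 'e::finite) pre_digraph"
    and b :: "real^'n" and \<phi> :: "'e \<Rightarrow> real \<Rightarrow> real"
    and g :: "real^'n \<Rightarrow> real^'n" and H :: "real^'n \<Rightarrow> real^'n^'n"
    and lam :: "nat \<Rightarrow> real^'n" and \<alpha> :: "nat \<Rightarrow> real" and d :: "nat \<Rightarrow> real^'n"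
    and L M \<epsilon> B \<delta> :: real and N k :: nat
  assumes "network G"
    and "(\<Sum>i\<in>UNIV. b $ i) = 0"
    and "\<forall>e. admissible_cost (\<phi> e)"
    and "dual_attained G b \<phi>"
    and g: "g = gradient (dual G b \<phi>)"
    and H: "H = hessian (dual G b \<phi>)"
    and "L > 0" and "\<forall>\<mu> \<nu>. onorm ((*v) (H \<mu> - H \<nu>)) \<le> L * norm (\<mu> - \<nu>)"
    and "M > 0" and "\<forall>\<mu>. onorm_on ones_perp (perp_inverse (H \<mu>)) \<le> M"
    and d: "\<forall>j. d j = - (add_approx N (H (lam j)) *v g (lam j))"
    and "\<forall>j. lam (Suc j) = lam j - \<alpha> j *\<^sub>R (add_approx N (H (lam j)) *v g (lam j))"
    and "\<forall>j. norm (H (lam j) *v d j + g (lam j)) \<le> \<epsilon>"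
    and B: "B = \<epsilon> + M^2 * L * \<epsilon>^2"
    and "norm (g (lam k)) \<le> 1 / (2 * M^2 * L)"
    and "\<forall>m. \<alpha> (k + m) = 1"
    and "0 < \<delta>" and "\<delta> < 1/2"
    and "B + M^2 * L * B^2 \<le> \<delta> / (4 * M^2 * L)"
  shows "(\<forall>m\<ge>1. norm (g (lam (k + m)))
            \<le> 1 / (2 ^ (2 ^ m) * M^2 * L) + B
               + \<delta> / (M^2 * L) * ((2 ^ (2 ^ m - 1) - 1) / 2 ^ (2 ^ m)))
       \<and> limsup (\<lambda>m. ereal (norm (g (lam (k + m))))) \<le> ereal (B + \<delta> / (2 * M^2 * L))"
proof -
  define a where "a = M^2 * L"
  have a: "a > 0"
    using \<open>L > 0\<close> \<open>M > 0\<close> by (simp add: a_def)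
  \<comment> \<open>As a bound on norms; this yields \<open>B \<ge> 0\<close>.\<close>
  have "\<epsilon> \<ge> 0"
    using assms(13) norm_ge_zero order_trans by blast
  then have B_nonneg: "B \<ge> 0"
    using a by (simp add: B a_def[symmetric])
  define u where "u m = norm (g (lam (k + m)))" for m
  have rec: "u (Suc m) \<le> a * (u m)^2 + B" for m
  proof -
    let ?j = "k + m"
    have step: "lam (k + Suc m) = lam ?j + d ?j"
      using assms(12,16) d by simp
    define r where "r = norm (H (lam ?j) *v d ?j + g (lam ?j))"
    have r: "0 \<le> r" "r \<le> \<epsilon>"
      using assms(13) by (auto simp: r_def)
    have "u (Suc m) \<le> r + a * r^2 + a * (u m)^2"
      unfolding u_def r_def a_def step unfolding g H
      by (rule inexact_newton_step) (use assms in auto)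
    \<comment> \<open>The residual terms increase with \<open>r\<close>, so the uniform bound turns
      them into \<open>B\<close>.\<close>
    also have "r + a * r^2 \<le> \<epsilon> + a * \<epsilon>^2"
      using r a by (intro add_mono mult_left_mono power_mono) auto
    finally show ?thesis
      by (simp add: B a_def)
  qed
  have bound: "u m \<le> (1 / 2 ^ (2 ^ m)) / a + B + \<delta> / a * (1/2 - 1 / 2 ^ (2 ^ m))" if "m \<ge> 1" for m
  proof (rule quadratic_recursion_bound[where u = u])
    show "B + a * B^2 \<le> \<delta> / (4 * a)" "u 0 \<le> 1 / (2 * a)"
      using assms(15,19) by (simp_all add: a_def u_def mult.assoc)
  qed (use a B_nonneg \<open>0 < \<delta>\<close> \<open>\<delta> < 1/2\<close> rec that in \<open>simp_all add: u_def\<close>)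
  \<comment> \<open>The exponent uses subtraction of naturals, which does not truncate because
    \<open>2 ^ m \<ge> 1\<close>.\<close>
  have half: "(2 ^ (2 ^ m - 1) - 1) / 2 ^ (2 ^ m) = 1/2 - 1 / (2::real) ^ (2 ^ m)" for m :: nat
  proof -
    have "(2::real) ^ (2 ^ m) = 2 * 2 ^ (2 ^ m - 1)"
      by (simp flip: power_Suc)
    then show ?thesis
      by (simp add: field_simps)
  qed
  have "u m \<le> 1 / (2 ^ (2 ^ m) * M^2 * L) + B
               + \<delta> / (M^2 * L) * ((2 ^ (2 ^ m - 1) - 1) / 2 ^ (2 ^ m))" if "m \<ge> 1" for m
    using bound[OF that] unfolding half by (simp add: a_def mult.assoc)
  moreover have "limsup (\<lambda>m. ereal (u m)) \<le> ereal (B + \<delta> / (2 * M^2 * L))"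
  proof -
    let ?c = "\<lambda>m::nat. (1 / 2 ^ (2 ^ m)) / a + B + \<delta> / a * (1/2 - 1 / 2 ^ (2 ^ m))"
    have "(\<lambda>m. 1 / (2::real) ^ (2 ^ m)) \<longlonglongrightarrow> 0"
      by real_asymp
    then have "?c \<longlonglongrightarrow> 0 / a + B + \<delta> / a * (1/2 - 0)"
      using a by (intro tendsto_intros) auto
    then have lim: "(\<lambda>m. ereal (?c m)) \<longlonglongrightarrow> ereal (B + \<delta> / (2 * M^2 * L))"
      by (simp add: a_def mult_ac)
    \<comment> \<open>The comparison starts at index 1, where \<open>bound\<close> becomes
      available.\<close>
    have "limsup (\<lambda>m. ereal (u m)) \<le> limsup (\<lambda>m. ereal (?c m))"
      using bound by (intro Limsup_mono eventually_sequentiallyI[of 1]) auto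
    also have "\<dots> = ereal (B + \<delta> / (2 * M^2 * L))"
      using lim by (intro lim_imp_Limsup) auto
    finally show ?thesis .
  qed
  ultimately show ?thesis
    unfolding u_def by blast
qed

end
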